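(* Let $d\ge 0$, $n\ge 2$ and $0\le k\le d$ be integers, let $p\in[0,1]$ and $q=1-p$, and let $C$ be the random cubical complex of the $d$-dimensional closed faces model with parameters $n$ and $p$. The expected value of $\mu_k(C)$, normalized by volume, is $$\frac{1}{n^d}\mathbb{E}(\mu_k(C))=\begin{cases}\displaystyle\sum_{i=k}^{d}(-1)^{i-k+1}\binom{d}{i}\binom{i}{k}q^{3^{d-i}} & \text{if } k<d,\\[2mm] 1-q=p & \text{if } k=d.\end{cases}$$ If moreover $n>2$, the normalized variance is $$\frac{1}{n^d}\mathrm{Var}(\mu_k(C))=\sum_{i=0}^d\sum_{j=0}^d\sum_{s=0}^d(-1)^{i+j}\binom{i}{k}\binom{j}{k}\binom{d}{s}N_{i,j,s}\left(P_{i,j,s}-P_iP_j\right),$$ where $$N_{i,j,s}=\sum_{\ell=0}^s(-1)^{s-\ell}\binom{s}{\ell}\binom{\ell}{i}\binom{\ell}{j}2^{s+\ell-i-j},\qquad P_i=1-q^{3^{d-i}},$$ $$P_{i,j,s}=\left(1-q^{3^{d-s}}\right)+q^{3^{d-s}}\left(1-q^{3^{d-i}-3^{d-s}}\right)\left(1-q^{3^{d-j}-3^{d-s}}\right).$$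
   Context: The lattice $\mathcal{L}$ is the $d$-dimensional torus $(\mathbb{R}/n\mathbb{Z})^d$ subdivided into $n^d$ unit $d$-cubes. An open $i$-cube of $\mathcal{L}$ ($0\le i\le d$) is a product of $d$ factors, each of which is either a point $\{a\}$ or an open unit interval $(a,a+1)$ with $a\in\mathbb{Z}/n\mathbb{Z}$, with exactly $i$ factors being intervals; $\mathcal{L}$ is the disjoint union of its open cubes. Intrinsic volumes: an open $i$-cube has $k$-th intrinsic volume $(-1)^{i-k}\binom{i}{k}$ (which is $0$ if $k>i$), and if $C$ is a union of open cubes of $\mathcal{L}$ then $\mu_k(C)$ is the sum of the $k$-th intrinsic volumes of the open cubes contained in $C$. Closed faces model: each open $i$-cube of $\mathcal{L}$, for all $i=0,1,\dots,d$, is selected independently with probability $p$, and $C$ is the closure of the union of all selected cubes. Conventions: $\binom{a}{b}=0$ if $b>a\ge0$; terms with $N_{i,j,s}=0$ (in particular all those with $s<\max(i,j)$) are read as $0$. *)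

theory Defs
  imports "HOL-Probability.Probability" "HOL-Library.Real_Mod"
begin

(* The circle R/nZ, with each class represented by its member in [0,n) and carrying the
   quotient topology of the real line; see quotient_map_circle. *)
definition circle :: "nat \<Rightarrow> real topology" where
  "circle n = topology (\<lambda>U. U \<subseteq> {0..<real n} \<and> open {x. x rmod real n \<in> U})"

lemma openin_circle:
  "openin (circle n) U \<longleftrightarrow> U \<subseteq> {0..<real n} \<and> open {x. x rmod real n \<in> U}"
proof -
  have "istopology (\<lambda>U. U \<subseteq> {0..<real n} \<and> open {x. x rmod real n \<in> U})"
    unfolding istopology_def
  proof (intro conjI allI impI)
    fix S T
    assume "S \<subseteq> {0..<real n} \<and> open {x. x rmod real n \<in> S}"
      and "T \<subseteq> {0..<real n} \<and> open {x. x rmod real n \<in> T}"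
    then show "S \<inter> T \<subseteq> {0..<real n}" "open {x. x rmod real n \<in> S \<inter> T}"
      using open_Int[of "{x. x rmod real n \<in> S}" "{x. x rmod real n \<in> T}"]
      by (auto simp: Int_def)
  next
    fix K
    assume K: "\<forall>S\<in>K. S \<subseteq> {0..<real n} \<and> open {x. x rmod real n \<in> S}"
    have "{x. x rmod real n \<in> \<Union>K} = (\<Union>S\<in>K. {x. x rmod real n \<in> S})" by auto
    with K show "\<Union>K \<subseteq> {0..<real n}" "open {x. x rmod real n \<in> \<Union>K}" by auto
  qed
  then show ?thesis by (simp add: circle_def)
qed

lemma topspace_circle: "n > 0 \<Longrightarrow> topspace (circle n) = {0..<real n}"
proof -
  assume n: "n > 0"
  then have "{x. x rmod real n \<in> {0..<real n}} = UNIV"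
    by (auto simp: rmod_nonneg rmod_less)
  then have "openin (circle n) {0..<real n}" by (simp add: openin_circle)
  then show ?thesis by (metis openin_circle openin_subset openin_topspace subset_antisym)
qed

lemma quotient_map_circle:
  "n > 0 \<Longrightarrow> quotient_map euclidean (circle n) (\<lambda>x. x rmod real n)"
proof -
  assume n: "n > 0"
  have "(\<lambda>x. x rmod real n) ` UNIV = {0..<real n}"
  proof
    show "(\<lambda>x. x rmod real n) ` UNIV \<subseteq> {0..<real n}"
      using n by (auto simp: rmod_nonneg rmod_less)
    show "{0..<real n} \<subseteq> (\<lambda>x. x rmod real n) ` UNIV"
    proof
      fix x assume "x \<in> {0..<real n}"
      then have "x rmod real n = x" by (simp add: rmod_idem)
      then show "x \<in> (\<lambda>x. x rmod real n) ` UNIV" by (metis UNIV_I image_eqI)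
    qed
  qed
  with n show ?thesis by (simp add: quotient_map_def openin_circle topspace_circle)
qed

definition torus :: "nat \<Rightarrow> nat \<Rightarrow> (nat \<Rightarrow> real) topology" where
  "torus d n = product_topology (\<lambda>_. circle n) {..<d}"

definition vertices :: "nat \<Rightarrow> real set set" where
  "vertices n = (\<lambda>a. {real a}) ` {..<n}"

(* The interval (n-1,n) needs no special treatment: its points are their own
   representatives in [0,n). *)
definition edges :: "nat \<Rightarrow> real set set" where
  "edges n = (\<lambda>a. {real a<..<real a + 1}) ` {..<n}"

definition open_cubes :: "nat \<Rightarrow> nat \<Rightarrow> nat \<Rightarrow> (nat \<Rightarrow> real) set set" where
  "open_cubes d n i = {Pi\<^sub>E {..<d} F | F.
     (\<forall>j<d. F j \<in> vertices n \<union> edges n) \<and> card {j. j < d \<and> F j \<in> edges n} = i}"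

lemma finite_open_cubes: "finite (open_cubes d n i)"
proof (rule finite_subset)
  show "open_cubes d n i \<subseteq> Pi\<^sub>E {..<d} ` (Pi\<^sub>E {..<d} (\<lambda>_. vertices n \<union> edges n))"
  proof
    fix Q assume "Q \<in> open_cubes d n i"
    then obtain F where F: "Q = Pi\<^sub>E {..<d} F" "\<forall>j<d. F j \<in> vertices n \<union> edges n"
      by (auto simp: open_cubes_def)
    then have "Q = Pi\<^sub>E {..<d} (restrict F {..<d})"
      by (auto simp: PiE_def Pi_def)
    moreover have "restrict F {..<d} \<in> Pi\<^sub>E {..<d} (\<lambda>_. vertices n \<union> edges n)"
      using F by auto
    ultimately show "Q \<in> Pi\<^sub>E {..<d} ` (Pi\<^sub>E {..<d} (\<lambda>_. vertices n \<union> edges n))" by blast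
  qed
  show "finite (Pi\<^sub>E {..<d} ` (Pi\<^sub>E {..<d} (\<lambda>_. vertices n \<union> edges n)))"
    by (intro finite_imageI finite_PiE) (auto simp: vertices_def edges_def)
qed

(* When k > i the truncated exponent is harmless, as the binomial coefficient vanishes. *)
definition intrinsic_volume :: "nat \<Rightarrow> nat \<Rightarrow> nat \<Rightarrow> (nat \<Rightarrow> real) set \<Rightarrow> real" where
  "intrinsic_volume d n k C =
     (\<Sum>i\<le>d. \<Sum>Q | Q \<in> open_cubes d n i \<and> Q \<subseteq> C. (-1) ^ (i - k) * real (i choose k))"

(* The law of the random complex: sel Q says whether Q is selected, and under Pi_pmf the
   sel Q are independent Bernoulli(p) variables. *)
definition closed_faces_model :: "nat \<Rightarrow> nat \<Rightarrow> real \<Rightarrow> (nat \<Rightarrow> real) set pmf" where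
  "closed_faces_model d n p =
     map_pmf (\<lambda>sel. torus d n closure_of \<Union>{Q. \<exists>i\<le>d. Q \<in> open_cubes d n i \<and> sel Q})
       (Pi_pmf (\<Union>i\<le>d. open_cubes d n i) False (\<lambda>_. bernoulli_pmf p))"

(* N_{i,j,s}: by Moebius inversion over the face lattice, the number of pairs of an i-face and
   a j-face of an s-cube not lying in a common proper face.  The exponent s + l - i - j
   truncates only where the product of binomial coefficients is 0. *)
definition spanning_face_pairs :: "nat \<Rightarrow> nat \<Rightarrow> nat \<Rightarrow> real" where
  "spanning_face_pairs i j s = (\<Sum>l\<le>s. (-1) ^ (s - l) * real (s choose l) *
     real (l choose i) * real (l choose j) * 2 ^ (s + l - i - j))"

definition face_prob :: "nat \<Rightarrow> real \<Rightarrow> nat \<Rightarrow> real" where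
  "face_prob d q i = 1 - q ^ 3 ^ (d - i)"

(* P_{i,j,s}.  The subtractions truncate only when s < max i j, where spanning_face_pairs i j s = 0. *)
definition joint_face_prob :: "nat \<Rightarrow> real \<Rightarrow> nat \<Rightarrow> nat \<Rightarrow> nat \<Rightarrow> real" where
  "joint_face_prob d q i j s = (1 - q ^ 3 ^ (d - s)) +
     q ^ 3 ^ (d - s) * (1 - q ^ (3 ^ (d - i) - 3 ^ (d - s))) * (1 - q ^ (3 ^ (d - j) - 3 ^ (d - s)))"

end

(* A cube Q lies in C iff some cube of its open star, i.e. some cube having Q as a face, is
   selected. The star of an i-cube has 3^(d-i) elements, which gives the expectation by linearity.
   For n > 2 two stars are either disjoint, and then the events Q \<subseteq> C and R \<subseteq> C are
   independent, or they meet in the star of the smallest cube spanned by Q and R. Everything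
   factors over the d coordinates, so the numbers of pairs of cubes with prescribed dimensions
   are the coefficients of n^d (1 + z (2 + 2x + 2y + xy))^d, while spanning_face_pairs i j s is
   the coefficient of x^i y^j in ((2 + x) (2 + y) - 2)^s. *)
theory Submission
  imports Defs
begin

section \<open>Closures of cells in the circle\<close>

text \<open>All probabilities are computed for the complementary events. A cube is absent from C
  exactly when every cube of its star is unselected, so absence has a power of q as its probability,
  and the joint absence of two cubes is an event of the same kind, for the union of the two stars.
  Complementing both events leaves a covariance unchanged, hence only the sizes of stars and of
  their intersections matter. The polynomial 2 + 2x + 2y + xy lists the pairs of faces of one edge
  that do not lie in a common endpoint, where x and y mark the faces equal to the edge itself: all
  pairs of faces give (2 + x) (2 + y), and 2 is subtracted for the endpoints paired with themselves.
  In 1 + z (2 + 2x + 2y + xy) the 1 stands for a vertex paired with itself, and z marks the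
  coordinates in which the two cubes span an edge. The counts come from comparing coefficients of
  real polynomial functions, so no bijection between pairs of cubes and pairs of faces has to be
  built.\<close>

lemma rmod_eq_iff:
  assumes "m > 0"
  shows "x rmod m = y rmod m \<longleftrightarrow> (\<exists>k::int. x = y + of_int k * m)"
proof
  assume "x rmod m = y rmod m"
  then have "x = y + of_int (\<lfloor>x / m\<rfloor> - \<lfloor>y / m\<rfloor>) * m"
    using assms by (simp add: rmod_def algebra_simps)
  then show "\<exists>k::int. x = y + of_int k * m" by blast
next
  assume "\<exists>k::int. x = y + of_int k * m"
  then obtain k :: int where k: "x = y + of_int k * m" by blast
  have "x / m = y / m + of_int k" using assms k by (simp add: field_simps)
  then show "x rmod m = y rmod m"
    using assms k by (simp add: rmod_def algebra_simps)
qed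

text \<open>The preimage of the image is the union of all translates of \<open>V\<close> by
  multiples of n, so the quotient map is open. Neighbourhoods that wrap around 0 are obtained as
  images of real intervals.\<close>

lemma openin_circle_image_rmod:
  assumes n: "n > 0" and V: "open V"
  shows "openin (circle n) ((\<lambda>x. x rmod real n) ` V)"
proof -
  have "{x. x rmod real n \<in> (\<lambda>x. x rmod real n) ` V} = (\<Union>k::int. (+) (of_int k * real n) ` V)"
    (is "?L = ?R")
  proof (intro set_eqI iffI)
    fix x assume "x \<in> ?L"
    then obtain v where v: "v \<in> V" "x rmod real n = v rmod real n" by auto
    then obtain k :: int where "x = v + of_int k * real n" using n by (auto simp: rmod_eq_iff)
    with v show "x \<in> ?R" by (auto simp: add.commute)
  next
    fix x assume "x \<in> ?R"
    then obtain v and k :: int where v: "v \<in> V" "x = v + of_int k * real n"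
      by (auto simp: add.commute)
    then have "x rmod real n = v rmod real n" using n by (subst rmod_eq_iff) auto
    with v show "x \<in> ?L" by auto
  qed
  moreover have "open ((+) (of_int k * real n) ` V)" for k :: int
    using V by (rule open_translation)
  ultimately have "open {x. x rmod real n \<in> (\<lambda>x. x rmod real n) ` V}" by auto
  moreover have "(\<lambda>x. x rmod real n) ` V \<subseteq> {0..<real n}"
    using n by (auto simp: rmod_nonneg rmod_less)
  ultimately show ?thesis by (simp add: openin_circle)
qed

definition cell :: "nat \<times> bool \<Rightarrow> real set" where
  "cell c = (if snd c then {real (fst c)<..<real (fst c) + 1} else {real (fst c)})"

definition cells :: "nat \<Rightarrow> (nat \<times> bool) set" where
  "cells n = {..<n} \<times> UNIV"

definition pred_mod :: "nat \<Rightarrow> nat \<Rightarrow> nat" where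
  "pred_mod n a = (if a = 0 then n - 1 else a - 1)"

definition succ_mod :: "nat \<Rightarrow> nat \<Rightarrow> nat" where
  "succ_mod n a = (if Suc a = n then 0 else Suc a)"

text \<open>The open star in the circle: the codes of the cells whose closure contains
  \<open>cell c\<close>. The agreement with the topology is the content of
  \<open>star_of_mem_closure_of_cell\<close> and \<open>cell_subset_closure_of_star\<close>.\<close>

definition star :: "nat \<Rightarrow> nat \<times> bool \<Rightarrow> (nat \<times> bool) set" where
  "star n c = (if snd c then {c} else {c, (fst c, True), (pred_mod n (fst c), True)})"

lemma finite_cells [simp]: "finite (cells n)"
  by (simp add: cells_def)

lemma star_subset: "c \<in> cells n \<Longrightarrow> star n c \<subseteq> cells n"
  by (auto simp: star_def cells_def pred_mod_def)

lemma finite_star [simp]: "finite (star n c)"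
  by (simp add: star_def)

lemma self_in_star [simp]: "c \<in> star n c"
  by (simp add: star_def)

text \<open>On a circle with at least two edges, the edges to the left and to the right of a vertex
  are different.\<close>

lemma card_star: "n \<ge> 2 \<Longrightarrow> card (star n c) = (if snd c then 1 else 3)"
  by (cases c) (auto simp: star_def pred_mod_def card_insert_if)

lemma cell_nonempty: "cell c \<noteq> {}"
  by (simp add: cell_def)

lemma cells_eqI:
  assumes "x \<in> cell c" "x \<in> cell c'"
  shows "c = c'"
proof -
  obtain a s b t where c: "c = (a, s)" "c' = (b, t)" by (cases c, cases c') auto
  have "real a \<le> x" "x < real (Suc a)" "real b \<le> x" "x < real (Suc b)"
    using assms by (auto simp: c cell_def split: if_splits)
  then have "real a < real (Suc b)" "real b < real (Suc a)" by linarith+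
  then have "a = b" unfolding of_nat_less_iff by simp
  then show ?thesis using assms by (auto simp: c cell_def split: if_splits)
qed

lemma cell_subset_circle: "c \<in> cells n \<Longrightarrow> cell c \<subseteq> {0..<real n}"
proof -
  assume "c \<in> cells n"
  then have "real (fst c) + 1 \<le> real n" by (auto simp: cells_def)
  then show ?thesis by (auto simp: cell_def)
qed

text \<open>The point has a neighbourhood that meets only cells of the star: an edge is itself open,
  and the image of (a - 1, a + 1) consists of the vertex a and its two edges. Since
  \<open>cell c'\<close> meets this neighbourhood and different cells are disjoint,
  \<open>c'\<close> is one of these cells.\<close>

lemma star_of_mem_closure_of_cell:
  assumes n: "n \<ge> 2" and c: "c \<in> cells n" "c' \<in> cells n"
    and x: "x \<in> cell c" "x \<in> circle n closure_of cell c'"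
  shows "c' \<in> star n c"
proof -
  have meets: "\<exists>y. y \<in> cell c' \<and> y \<in> T" if "x \<in> T" "openin (circle n) T" for T
    using x(2) that unfolding in_closure_of by blast
  obtain a s where a: "c = (a, s)" "a < n" using c by (auto simp: cells_def)
  show ?thesis
  proof (cases s)
    case True
    have "z rmod real n = z" if "z \<in> cell c" for z
      using cell_subset_circle[OF c(1)] that by (intro rmod_idem) auto
    then have "(\<lambda>z. z rmod real n) ` cell c = cell c" by auto
    moreover have "open (cell c)" using a True by (simp add: cell_def)
    ultimately have "openin (circle n) (cell c)"
      using openin_circle_image_rmod[of n "cell c"] n by simp
    then obtain y where "y \<in> cell c'" "y \<in> cell c" using meets x by blast
    then have "c' = c" by (rule cells_eqI)
    then show ?thesis by simp
  next
    case False
    let ?V = "{real a - 1<..<real a + 1}"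
    have x_eq: "x = real a" using x a False by (simp add: cell_def)
    have "x rmod real n = x" using a x_eq by (intro rmod_idem) auto
    then have xV: "x \<in> (\<lambda>z. z rmod real n) ` ?V" using x_eq by (intro image_eqI[of _ _ x]) auto
    have "openin (circle n) ((\<lambda>z. z rmod real n) ` ?V)"
      using n by (intro openin_circle_image_rmod) auto
    from meets[OF xV this] obtain z where z: "z \<in> ?V" "z rmod real n \<in> cell c'" by auto
    show ?thesis
    proof (cases "a = 0 \<and> z < 0")
      case True
      \<comment> \<open>The only case of wrapping around: left of vertex 0 lies the last edge, and
        the integer quotient of z by n is -1.\<close>
      have "z rmod real n = z + real n"
        using True z n by (intro rmod_unique[of _ _ _ "-1"]) auto
      moreover have "z + real n \<in> cell (n - 1, True)" using True z n by (auto simp: cell_def)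
      ultimately have "c' = (n - 1, True)" using z by (intro cells_eqI[of "z rmod real n"]) auto
      then show ?thesis using True a False by (simp add: star_def pred_mod_def)
    next
      case nonneg: False
      have an: "real a + 1 \<le> real n" using a by linarith
      have "0 \<le> z"
      proof (cases "a = 0")
        case False
        then have "real a \<ge> 1" by linarith
        then show ?thesis using z by auto
      qed (use nonneg in auto)
      then have "z rmod real n = z" using z an by (intro rmod_idem) auto
      then have zc: "c' = e" if "z \<in> cell e" for e using z(2) that cells_eqI by simp
      have "z \<in> cell (a - 1, True) \<and> a \<noteq> 0 \<or> z \<in> cell (a, False) \<or> z \<in> cell (a, True)"
        using z \<open>0 \<le> z\<close> by (cases "a = 0") (auto simp: cell_def of_nat_diff)
      then have "c' = (a - 1, True) \<and> a \<noteq> 0 \<or> c' = (a, False) \<or> c' = (a, True)"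
        using zc by blast
      moreover have "star n c = {(a, False), (a, True), (pred_mod n a, True)}"
        using \<open>\<not> s\<close> by (simp add: a(1) star_def)
      ultimately show ?thesis by (auto simp: pred_mod_def)
    qed
  qed
qed

text \<open>Continuity of the quotient map carries the closure in the line into the closure in the
  circle. The right endpoint a + 1 may be n, which reduces to 0; in this way vertex 0 becomes an
  endpoint of the last edge.\<close>

lemma rmod_mem_closure_of_edge:
  assumes n: "n > 0" and a: "a < n" and x: "x \<in> {real a..real a + 1}"
  shows "x rmod real n \<in> circle n closure_of cell (a, True)"
proof -
  have "continuous_map euclidean (circle n) (\<lambda>x. x rmod real n)"
    using quotient_map_circle[OF n] by (rule quotient_imp_continuous_map)
  then have "(\<lambda>x. x rmod real n) ` closure (cell (a, True))
      \<subseteq> circle n closure_of (\<lambda>x. x rmod real n) ` cell (a, True)"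
    by (metis continuous_map_image_closure_subset euclidean_closure_of)
  moreover have "z rmod real n = z" if "z \<in> cell (a, True)" for z
    using cell_subset_circle[of "(a, True)" n] that a
    by (intro rmod_idem) (auto simp: cells_def)
  then have "(\<lambda>x. x rmod real n) ` cell (a, True) = cell (a, True)" by auto
  moreover have "x \<in> closure (cell (a, True))" using x by (simp add: cell_def)
  ultimately show ?thesis by auto
qed

lemma cell_subset_closure_of_star:
  assumes n: "n \<ge> 2" and c: "c \<in> cells n" and c': "c' \<in> star n c"
  shows "cell c \<subseteq> circle n closure_of cell c'"
proof (cases "c' = c")
  case True
  show ?thesis using cell_subset_circle[OF c] n
    by (simp add: True closure_of_subset topspace_circle)
next
  case False
  obtain a where a: "c = (a, False)" "a < n" and
      c'_eq: "c' = (a, True) \<or> c' = (pred_mod n a, True)"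
    using False c c' by (cases c) (auto simp: star_def cells_def split: if_splits)
  have "real a \<in> circle n closure_of cell c'"
  proof (cases "c' = (a, True)")
    case True
    have "real a rmod real n = real a" using a by (intro rmod_idem) auto
    then show ?thesis using rmod_mem_closure_of_edge[of n a "real a"] a n True by auto
  next
    case False
    then have c'': "c' = (pred_mod n a, True)" using c'_eq by simp
    have "pred_mod n a < n" using a by (auto simp: pred_mod_def)
    moreover have "(real (pred_mod n a) + 1) rmod real n = real a"
    proof (cases "a = 0")
      case True
      then have "real (pred_mod n a) + 1 = real n"
        using n by (simp add: pred_mod_def of_nat_diff)
      then show ?thesis using True by simp
    next
      case False
      then have "real (pred_mod n a) + 1 = real a" by (simp add: pred_mod_def of_nat_diff)
      then show ?thesis using a by simp
    qed
    ultimately show ?thesis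
      using rmod_mem_closure_of_edge[of n "pred_mod n a" "real (pred_mod n a) + 1"] n c'' by auto
  qed
  then show ?thesis using a by (simp add: cell_def)
qed

section \<open>Cubes of the torus\<close>

definition cubes :: "nat \<Rightarrow> nat \<Rightarrow> (nat \<Rightarrow> nat \<times> bool) set" where
  "cubes d n = PiE {..<d} (\<lambda>_. cells n)"

definition cube :: "nat \<Rightarrow> (nat \<Rightarrow> nat \<times> bool) \<Rightarrow> (nat \<Rightarrow> real) set" where
  "cube d H = PiE {..<d} (\<lambda>j. cell (H j))"

definition cube_dim :: "nat \<Rightarrow> (nat \<Rightarrow> nat \<times> bool) \<Rightarrow> nat" where
  "cube_dim d H = card {j. j < d \<and> snd (H j)}"

text \<open>The open star of the cube coded by \<open>H\<close>, including \<open>H\<close>. It is a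
  product of stars because closures of products in the torus are products of closures in the
  circle.\<close>

definition cofaces :: "nat \<Rightarrow> nat \<Rightarrow> (nat \<Rightarrow> nat \<times> bool) \<Rightarrow> (nat \<Rightarrow> nat \<times> bool) set" where
  "cofaces d n H = PiE {..<d} (\<lambda>j. star n (H j))"

lemma finite_cubes [simp]: "finite (cubes d n)"
  by (simp add: cubes_def finite_PiE)

lemma cofaces_subset: "H \<in> cubes d n \<Longrightarrow> cofaces d n H \<subseteq> cubes d n"
  unfolding cofaces_def cubes_def by (intro PiE_mono star_subset) auto

lemma finite_cofaces [simp]: "finite (cofaces d n H)"
  by (simp add: cofaces_def finite_PiE)

lemma cube_dim_le: "cube_dim d H \<le> d"
  unfolding cube_dim_def using card_mono[of "{..<d}" "{j. j < d \<and> snd (H j)}"] by auto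

text \<open>Lets codes be counted in place of cubes; in particular, different cofaces have different
  selection bits.\<close>

lemma inj_on_cube: "inj_on (cube d) (cubes d n)"
proof (rule inj_onI)
  fix H G assume H: "H \<in> cubes d n" and G: "G \<in> cubes d n" and eq: "cube d H = cube d G"
  then have "\<forall>j\<in>{..<d}. cell (H j) = cell (G j)"
    unfolding cube_def by (subst (asm) PiE_eq_iff_not_empty) (auto simp: cell_nonempty)
  then have "H j = G j" if "j \<in> {..<d}" for j
    using that cell_nonempty[of "H j"] cells_eqI by blast
  then show "H = G" using H G unfolding cubes_def by (intro PiE_ext)
qed

lemma cell_in_edges_iff:
  assumes "c \<in> cells n"
  shows "cell c \<in> edges n \<longleftrightarrow> snd c"
proof
  assume "cell c \<in> edges n"
  then have "infinite (cell c)" by (auto simp: edges_def infinite_Ioo)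
  then show "snd c" by (auto simp: cell_def split: if_splits)
qed (use assms in \<open>auto simp: cell_def cells_def edges_def\<close>)

lemma vertices_edges_eq: "vertices n \<union> edges n = cell ` cells n"
proof
  show "vertices n \<union> edges n \<subseteq> cell ` cells n"
  proof
    fix e assume "e \<in> vertices n \<union> edges n"
    then obtain a where "a < n" "e = cell (a, False) \<or> e = cell (a, True)"
      by (auto simp: vertices_def edges_def cell_def)
    then show "e \<in> cell ` cells n" by (auto simp: cells_def)
  qed
qed (auto simp: cell_def cells_def vertices_def edges_def)

lemma open_cubes_eq: "open_cubes d n i = cube d ` {H \<in> cubes d n. cube_dim d H = i}"
proof
  show "cube d ` {H \<in> cubes d n. cube_dim d H = i} \<subseteq> open_cubes d n i"
  proof safe
    fix H assume H: "H \<in> cubes d n"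
    then have "H j \<in> cells n" if "j < d" for j using that by (auto simp: cubes_def)
    then have "\<forall>j<d. cell (H j) \<in> vertices n \<union> edges n"
      "{j. j < d \<and> cell (H j) \<in> edges n} = {j. j < d \<and> snd (H j)}"
      by (auto simp: vertices_edges_eq cell_in_edges_iff)
    then show "cube d H \<in> open_cubes d n (cube_dim d H)"
      unfolding open_cubes_def cube_dim_def cube_def mem_Collect_eq
      by (intro exI[of _ "\<lambda>j. cell (H j)"]) simp
  qed
next
  show "open_cubes d n i \<subseteq> cube d ` {H \<in> cubes d n. cube_dim d H = i}"
  proof
    fix Q assume "Q \<in> open_cubes d n i"
    then obtain F where F: "Q = Pi\<^sub>E {..<d} F" "\<forall>j<d. F j \<in> cell ` cells n"
      "card {j. j < d \<and> F j \<in> edges n} = i"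
      by (auto simp: open_cubes_def vertices_edges_eq)
    then have "\<forall>j. \<exists>c. j < d \<longrightarrow> c \<in> cells n \<and> F j = cell c" by blast
    then obtain H0 where H0: "\<And>j. j < d \<Longrightarrow> H0 j \<in> cells n \<and> F j = cell (H0 j)" by metis
    define H where "H = restrict H0 {..<d}"
    have H: "H \<in> cubes d n" using H0 by (auto simp: H_def cubes_def)
    have FH: "F j = cell (H j) \<and> H j \<in> cells n" if "j < d" for j using H0 that by (simp add: H_def)
    have "Q = cube d H" unfolding F(1) cube_def using FH by (intro PiE_cong) auto
    moreover have "{j. j < d \<and> F j \<in> edges n} = {j. j < d \<and> snd (H j)}"
      using FH by (auto simp: cell_in_edges_iff)
    then have "cube_dim d H = i" using F(3) by (simp add: cube_dim_def)
    ultimately show "Q \<in> cube d ` {H \<in> cubes d n. cube_dim d H = i}" using H by blast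
  qed
qed

lemma UN_open_cubes: "(\<Union>i\<le>d. open_cubes d n i) = cube d ` cubes d n"
  using cube_dim_le by (auto simp: open_cubes_eq)

text \<open>Closure commutes with the finite union of selected cubes and with products. A single
  point of \<open>cube d H\<close> in the closure of \<open>cube d G\<close> already forces
  \<open>G\<close> into the star, coordinate by coordinate, and a cube whose star contains
  \<open>G\<close> lies entirely in that closure.\<close>

lemma cube_subset_closure_iff:
  assumes n: "n \<ge> 2" and H: "H \<in> cubes d n"
  shows "cube d H \<subseteq> torus d n closure_of \<Union>{Q. \<exists>i\<le>d. Q \<in> open_cubes d n i \<and> sel Q}
    \<longleftrightarrow> (\<exists>G\<in>cofaces d n H. sel (cube d G))"
proof -
  have eq: "{Q. \<exists>i\<le>d. Q \<in> open_cubes d n i \<and> sel Q} = cube d ` {G \<in> cubes d n. sel (cube d G)}"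
  proof -
    have "{Q. \<exists>i\<le>d. Q \<in> open_cubes d n i \<and> sel Q} = {Q \<in> \<Union>i\<le>d. open_cubes d n i. sel Q}"
      by auto
    also have "\<dots> = cube d ` {G \<in> cubes d n. sel (cube d G)}"
      unfolding UN_open_cubes by auto
    finally show ?thesis .
  qed
  have closure: "torus d n closure_of \<Union>{Q. \<exists>i\<le>d. Q \<in> open_cubes d n i \<and> sel Q}
      = (\<Union>G\<in>{G \<in> cubes d n. sel (cube d G)}. PiE {..<d} (\<lambda>j. circle n closure_of cell (G j)))"
    unfolding eq by (subst closure_of_Union) (auto simp: torus_def cube_def closure_of_product_topology)
  have Hj: "H j \<in> cells n" if "j < d" for j using H that by (auto simp: cubes_def)
  show ?thesis unfolding closure
  proof
    assume sub: "cube d H \<subseteq>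
      (\<Union>G\<in>{G \<in> cubes d n. sel (cube d G)}. PiE {..<d} (\<lambda>j. circle n closure_of cell (G j)))"
    have "cube d H \<noteq> {}" by (simp add: cube_def PiE_eq_empty_iff cell_nonempty)
    then obtain x where x: "x \<in> cube d H" by auto
    from subsetD[OF sub this] obtain G where G: "G \<in> cubes d n" "sel (cube d G)"
      "x \<in> PiE {..<d} (\<lambda>j. circle n closure_of cell (G j))" by auto
    have "G j \<in> star n (H j)" if "j < d" for j
    proof (rule star_of_mem_closure_of_cell[OF n])
      show "G j \<in> cells n" using G that by (auto simp: cubes_def)
      show "x j \<in> cell (H j)" using x that by (auto simp: cube_def)
      show "x j \<in> circle n closure_of cell (G j)" using G that by auto
    qed (use Hj that in auto)
    then have "G \<in> cofaces d n H" using G by (auto simp: cofaces_def cubes_def PiE_iff)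
    then show "\<exists>G\<in>cofaces d n H. sel (cube d G)" using G by blast
  next
    assume "\<exists>G\<in>cofaces d n H. sel (cube d G)"
    then obtain G where G: "G \<in> cofaces d n H" "sel (cube d G)" by blast
    have "cell (H j) \<subseteq> circle n closure_of cell (G j)" if "j < d" for j
      using G that Hj by (intro cell_subset_closure_of_star[OF n]) (auto simp: cofaces_def)
    then have "cube d H \<subseteq> PiE {..<d} (\<lambda>j. circle n closure_of cell (G j))"
      unfolding cube_def by (intro PiE_mono) auto
    then show "cube d H \<subseteq>
      (\<Union>G\<in>{G \<in> cubes d n. sel (cube d G)}. PiE {..<d} (\<lambda>j. circle n closure_of cell (G j)))"
      using G cofaces_subset[OF H] by auto
  qed
qed

text \<open>The dependence on \<open>C\<close> moves from the index set into an indicator, so that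
  expectations can be taken term by term.\<close>

lemma intrinsic_volume_eq:
  "intrinsic_volume d n k C = (\<Sum>H\<in>cubes d n.
     (-1) ^ (cube_dim d H - k) * real (cube_dim d H choose k) * of_bool (cube d H \<subseteq> C))"
proof -
  have "(\<Sum>Q | Q \<in> open_cubes d n i \<and> Q \<subseteq> C. (-1) ^ (i - k) * real (i choose k)) =
      (\<Sum>H | H \<in> cubes d n \<and> cube_dim d H = i.
         (-1) ^ (cube_dim d H - k) * real (cube_dim d H choose k) * of_bool (cube d H \<subseteq> C))" for i
  proof -
    have "{Q. Q \<in> open_cubes d n i \<and> Q \<subseteq> C}
        = cube d ` {H. H \<in> cubes d n \<and> cube_dim d H = i \<and> cube d H \<subseteq> C}"
      by (auto simp: open_cubes_eq)
    then have "(\<Sum>Q | Q \<in> open_cubes d n i \<and> Q \<subseteq> C. (-1) ^ (i - k) * real (i choose k)) =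
      (\<Sum>H | H \<in> cubes d n \<and> cube_dim d H = i \<and> cube d H \<subseteq> C.
         (-1) ^ (cube_dim d H - k) * real (cube_dim d H choose k))"
      by (simp only:) (subst sum.reindex, auto intro: inj_on_subset[OF inj_on_cube])
    also have "\<dots> = (\<Sum>H | H \<in> cubes d n \<and> cube_dim d H = i.
         (-1) ^ (cube_dim d H - k) * real (cube_dim d H choose k) * of_bool (cube d H \<subseteq> C))"
      by (intro sum.mono_neutral_cong_left) auto
    finally show ?thesis .
  qed
  note sum_open_cubes = this
  have "intrinsic_volume d n k C = (\<Sum>i\<in>{..d}. \<Sum>H | H \<in> cubes d n \<and> cube_dim d H = i.
         (-1) ^ (cube_dim d H - k) * real (cube_dim d H choose k) * of_bool (cube d H \<subseteq> C))"
    unfolding intrinsic_volume_def sum_open_cubes ..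
  also have "\<dots> = (\<Sum>H\<in>cubes d n.
     (-1) ^ (cube_dim d H - k) * real (cube_dim d H choose k) * of_bool (cube d H \<subseteq> C))"
    by (rule sum.group) (auto simp: cube_dim_le)
  finally show ?thesis .
qed

section \<open>Counting by generating functions\<close>

lemma sum_expand_by_value:
  fixes w :: "'a \<Rightarrow> real"
  assumes fin: "finite T" and sub: "K ` C \<subseteq> T"
  shows "(\<Sum>a\<in>C. w a * \<phi> (K a)) = (\<Sum>t\<in>T. (\<Sum>a\<in>C. w a * of_bool (K a = t)) * \<phi> t)"
proof -
  have "\<phi> (K a) = (\<Sum>t\<in>T. of_bool (K a = t) * \<phi> t)" if "a \<in> C" for a
  proof -
    have "(\<Sum>t\<in>T. of_bool (K a = t) * \<phi> t) = (\<Sum>t\<in>T. if K a = t then \<phi> t else 0)"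
      by (intro sum.cong) auto
    also have "\<dots> = \<phi> (K a)"
      using fin that sub by (subst sum.delta') auto
    finally show ?thesis by simp
  qed
  then have "(\<Sum>a\<in>C. w a * \<phi> (K a)) = (\<Sum>a\<in>C. \<Sum>t\<in>T. w a * of_bool (K a = t) * \<phi> t)"
    by (intro sum.cong refl) (simp only: sum_distrib_left mult.assoc)
  also have "\<dots> = (\<Sum>t\<in>T. (\<Sum>a\<in>C. w a * of_bool (K a = t)) * \<phi> t)"
    by (subst sum.swap) (simp only: sum_distrib_right)
  finally show ?thesis .
qed

lemma sum_mult_eq_of_indicators:
  fixes u :: "'a \<Rightarrow> real" and v :: "'b \<Rightarrow> real"
  assumes fin: "finite A" "finite B"
    and eq: "\<And>t. (\<Sum>a\<in>A. u a * of_bool (F a = t)) = (\<Sum>b\<in>B. v b * of_bool (G b = t))"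
  shows "(\<Sum>a\<in>A. u a * \<phi> (F a)) = (\<Sum>b\<in>B. v b * \<phi> (G b))"
proof -
  let ?T = "F ` A \<union> G ` B"
  have "(\<Sum>a\<in>A. u a * \<phi> (F a)) = (\<Sum>t\<in>?T. (\<Sum>a\<in>A. u a * of_bool (F a = t)) * \<phi> t)"
    using fin by (intro sum_expand_by_value) auto
  also have "\<dots> = (\<Sum>t\<in>?T. (\<Sum>b\<in>B. v b * of_bool (G b = t)) * \<phi> t)" by (simp only: eq)
  also have "\<dots> = (\<Sum>b\<in>B. v b * \<phi> (G b))"
    using fin by (intro sum_expand_by_value[symmetric]) auto
  finally show ?thesis .
qed

text \<open>Grouped by exponent, both sides are polynomials in x whose coefficients are the total
  weights of the fibres of \<open>f\<close> and \<open>g\<close>; real polynomials that agree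
  everywhere have equal coefficients.\<close>

lemma sum_power_eq_indicators:
  fixes u :: "'a \<Rightarrow> real" and v :: "'b \<Rightarrow> real"
  assumes fin: "finite A" "finite B"
    and eq: "\<And>x. (\<Sum>a\<in>A. u a * x ^ f a) = (\<Sum>b\<in>B. v b * x ^ g b)"
  shows "(\<Sum>a\<in>A. u a * of_bool (f a = m)) = (\<Sum>b\<in>B. v b * of_bool (g b = m))"
proof -
  \<comment> \<open>A common degree bound; \<open>m\<close> is inserted so that its coefficient is
    among those compared even if no exponent equals it.\<close>
  define M where "M = Max (insert m (f ` A \<union> g ` B))"
  have M: "m \<le> M" "f ` A \<subseteq> {..M}" "g ` B \<subseteq> {..M}"
    using fin unfolding M_def by (auto intro!: Max_ge)
  have "\<forall>x. (\<Sum>i\<le>M. (\<Sum>a\<in>A. u a * of_bool (f a = i)) * x ^ i)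
      = (\<Sum>i\<le>M. (\<Sum>b\<in>B. v b * of_bool (g b = i)) * x ^ i)"
    using eq by (simp flip: sum_expand_by_value[OF finite_atMost M(2)]
        sum_expand_by_value[OF finite_atMost M(3)])
  from this[unfolded polyfun_eq_coeffs] M(1) show ?thesis by blast
qed

text \<open>Coefficients are extracted for z, then y, then x, with the powers of the remaining
  variables treated as part of the weights. An identity of generating functions thereby becomes an
  identity for every function \<phi> of the three exponents.\<close>

lemma sum_power3_eq:
  fixes u :: "'a \<Rightarrow> real" and v :: "'b \<Rightarrow> real"
  assumes fin: "finite A" "finite B"
    and eq: "\<And>x y z. (\<Sum>a\<in>A. u a * x ^ f1 a * y ^ f2 a * z ^ f3 a) =
                      (\<Sum>b\<in>B. v b * x ^ g1 b * y ^ g2 b * z ^ g3 b)"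
  shows "(\<Sum>a\<in>A. u a * \<phi> (f1 a) (f2 a) (f3 a)) = (\<Sum>b\<in>B. v b * \<phi> (g1 b) (g2 b) (g3 b))"
proof -
  have 1: "(\<Sum>a\<in>A. u a * x ^ f1 a * y ^ f2 a * of_bool (f3 a = s)) =
        (\<Sum>b\<in>B. v b * x ^ g1 b * y ^ g2 b * of_bool (g3 b = s))" for x y s
    by (rule sum_power_eq_indicators[OF fin]) (rule eq)
  have 2: "(\<Sum>a\<in>A. u a * x ^ f1 a * of_bool (f3 a = s) * of_bool (f2 a = j)) =
        (\<Sum>b\<in>B. v b * x ^ g1 b * of_bool (g3 b = s) * of_bool (g2 b = j))" for x s j
    by (rule sum_power_eq_indicators[OF fin]) (use 1[of x _ s] in \<open>simp only: ac_simps\<close>)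
  have 3: "(\<Sum>a\<in>A. u a * of_bool (f3 a = s) * of_bool (f2 a = j) * of_bool (f1 a = i)) =
        (\<Sum>b\<in>B. v b * of_bool (g3 b = s) * of_bool (g2 b = j) * of_bool (g1 b = i))" for s j i
    by (rule sum_power_eq_indicators[OF fin]) (use 2[of _ s j] in \<open>simp only: ac_simps\<close>)
  have "(\<Sum>a\<in>A. u a * of_bool ((f1 a, f2 a, f3 a) = t)) =
        (\<Sum>b\<in>B. v b * of_bool ((g1 b, g2 b, g3 b) = t))" for t
  proof -
    obtain i j s where t: "t = (i, j, s)" by (cases t)
    show ?thesis using 3[of s j i] by (simp only: t prod.inject of_bool_conj ac_simps)
  qed
  from sum_mult_eq_of_indicators[OF fin this, of "\<lambda>(i, j, s). \<phi> i j s"] show ?thesis by simp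
qed

section \<open>Cubes and pairs of faces counted by dimension\<close>

lemma prod_if_eq_power_card:
  "(\<Prod>j<d. if P j then x else 1) = (x :: real) ^ card {j. j < d \<and> P j}" for d :: nat
proof -
  have "{..<d} \<inter> {j. P j} = {j. j < d \<and> P j}" by auto
  then show ?thesis by (simp add: prod.If_cases)
qed

lemma prod_of_bool_eq:
  "(\<Prod>j<d. of_bool (P j)) = (of_bool (\<forall>j<d. P j) :: real)" for d :: nat
  by (induction d) (auto simp: less_Suc_eq)

lemma sum_cells: "(\<Sum>c\<in>cells n. f c) = (\<Sum>a<n. f (a, False) + f (a, True) :: real)"
proof -
  have "(\<Sum>c\<in>cells n. f c) = (\<Sum>a<n. \<Sum>t\<in>UNIV. f (a, t))"
    unfolding cells_def by (subst sum.cartesian_product) simp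
  then show ?thesis by (simp add: UNIV_bool add.commute)
qed

text \<open>Each coordinate offers n vertices of weight 1 and n edges of weight x, so the generating
  function of the dimension is (n (x + 1))^d.\<close>

lemma sum_cubes_by_dim:
  fixes \<phi> :: "nat \<Rightarrow> real"
  shows "(\<Sum>H\<in>cubes d n. \<phi> (cube_dim d H)) = real n ^ d * (\<Sum>i\<le>d. real (d choose i) * \<phi> i)"
proof -
  have "(\<Sum>H\<in>cubes d n. 1 * x ^ cube_dim d H)
      = (\<Sum>i\<le>d. (real n ^ d * real (d choose i)) * x ^ i)" for x :: real
  proof -
    have "(\<Sum>H\<in>cubes d n. 1 * x ^ cube_dim d H)
        = (\<Sum>H\<in>cubes d n. \<Prod>j<d. if snd (H j) then x else 1)"
      by (simp add: prod_if_eq_power_card cube_dim_def)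
    also have "\<dots> = (\<Prod>j<d. \<Sum>c\<in>cells n. if snd c then x else 1)"
      unfolding cubes_def by (subst prod_sum_PiE) auto
    also have "\<dots> = (real n * (x + 1)) ^ d" by (simp add: sum_cells add.commute)
    also have "\<dots> = real n ^ d * (\<Sum>i\<le>d. real (d choose i) * x ^ i)"
      by (simp add: power_mult_distrib binomial_ring)
    finally show ?thesis by (simp add: sum_distrib_left mult.assoc)
  qed
  note eq = this
  have "(\<Sum>H\<in>cubes d n. 1 * of_bool (cube_dim d H = m)) =
     (\<Sum>i\<le>d. (real n ^ d * real (d choose i)) * of_bool (i = m))" for m
    by (rule sum_power_eq_indicators[OF finite_cubes finite_atMost eq])
  from sum_mult_eq_of_indicators[OF _ _ this, of \<phi>] show ?thesis
    by (simp add: sum_distrib_left mult.assoc)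
qed

text \<open>An l-cube has \<open>(l choose i) * 2 ^ (l - i)\<close> faces of dimension i, and each
  of its l coordinates contributes two endpoints or the whole edge. Summing up to d rather than l
  gives an index range that does not depend on l.\<close>

lemma sum_binomial_power_two:
  assumes "l \<le> d"
  shows "(\<Sum>i\<le>d. real (l choose i) * 2 ^ (l - i) * x ^ i) = (x + 2) ^ l"
proof -
  have "(x + 2) ^ l = (\<Sum>i\<le>l. real (l choose i) * x ^ i * 2 ^ (l - i))"
    by (simp add: binomial_ring)
  also have "\<dots> = (\<Sum>i\<le>d. real (l choose i) * 2 ^ (l - i) * x ^ i)"
    using assms by (intro sum.mono_neutral_cong_left) auto
  finally show ?thesis by simp
qed

text \<open>The power of 2 splits as \<open>2 ^ (s - l)\<close> times the face-counting factors
  \<open>2 ^ (l - i)\<close> and \<open>2 ^ (l - j)\<close>. For fixed l the sums over i and j then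
  factor into (x + 2)^l (y + 2)^l, and the sum over l is the binomial expansion of ((x + 2) (y + 2)
  - 2)^s.\<close>

lemma spanning_face_pairs_generating_function:
  assumes "s \<le> d"
  shows "(\<Sum>i\<le>d. \<Sum>j\<le>d. spanning_face_pairs i j s * x ^ i * y ^ j)
    = (2 + 2 * x + 2 * y + x * y) ^ s"
proof -
  have pow: "real (l choose i) * real (l choose j) * 2 ^ (s + l - i - j)
      = (2::real) ^ (s - l) * (real (l choose i) * 2 ^ (l - i)) * (real (l choose j) * 2 ^ (l - j))"
    if "l \<le> s" for i j l
  proof (cases "i \<le> l \<and> j \<le> l")
    case True
    then have "s + l - i - j = (s - l) + (l - i) + (l - j)" using that by linarith
    then show ?thesis by (simp add: power_add)
  next
    case False
    then have "l < i \<or> l < j" by linarith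
    then show ?thesis by auto
  qed
  have "(\<Sum>i\<le>d. \<Sum>j\<le>d. spanning_face_pairs i j s * x ^ i * y ^ j) =
     (\<Sum>i\<le>d. \<Sum>j\<le>d. \<Sum>l\<le>s. real (s choose l) * (-2) ^ (s - l) *
        ((real (l choose i) * 2 ^ (l - i) * x ^ i) * (real (l choose j) * 2 ^ (l - j) * y ^ j)))"
  proof (intro sum.cong refl)
    fix i j
    have "(-1) ^ (s - l) * real (s choose l) * real (l choose i) * real (l choose j)
          * 2 ^ (s + l - i - j) * x ^ i * y ^ j
        = real (s choose l) * (-2) ^ (s - l) *
        ((real (l choose i) * 2 ^ (l - i) * x ^ i) * (real (l choose j) * 2 ^ (l - j) * y ^ j))"
      if "l \<le> s" for l
    proof -
      have minus: "(-2 :: real) ^ (s - l) = (-1) ^ (s - l) * 2 ^ (s - l)"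
        by (simp flip: power_mult_distrib)
      have assoc: "(-1) ^ (s - l) * real (s choose l) * real (l choose i) * real (l choose j)
          * 2 ^ (s + l - i - j) * x ^ i * y ^ j
        = (-1) ^ (s - l) * real (s choose l) * (real (l choose i) * real (l choose j)
          * 2 ^ (s + l - i - j)) * x ^ i * y ^ j" by (simp only: mult.assoc)
      show ?thesis unfolding assoc pow[OF that] minus by (simp only: ac_simps)
    qed
    then show "spanning_face_pairs i j s * x ^ i * y ^ j =
       (\<Sum>l\<le>s. real (s choose l) * (-2) ^ (s - l) *
        ((real (l choose i) * 2 ^ (l - i) * x ^ i) * (real (l choose j) * 2 ^ (l - j) * y ^ j)))"
      unfolding spanning_face_pairs_def sum_distrib_right by (intro sum.cong refl) auto
  qed
  also have "\<dots> = (\<Sum>l\<le>s. \<Sum>i\<le>d. \<Sum>j\<le>d. real (s choose l) * (-2) ^ (s - l) *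
        ((real (l choose i) * 2 ^ (l - i) * x ^ i) * (real (l choose j) * 2 ^ (l - j) * y ^ j)))"
    by (subst (2) sum.swap, subst sum.swap) (rule refl)
  also have "\<dots> = (\<Sum>l\<le>s. real (s choose l) * (-2) ^ (s - l) * ((x + 2) ^ l * (y + 2) ^ l))"
  proof (intro sum.cong refl)
    fix l assume "l \<in> {..s}"
    then have "l \<le> d" using assms by simp
    have "(\<Sum>i\<le>d. \<Sum>j\<le>d. real (s choose l) * (-2) ^ (s - l) *
        ((real (l choose i) * 2 ^ (l - i) * x ^ i) * (real (l choose j) * 2 ^ (l - j) * y ^ j)))
      = real (s choose l) * (-2) ^ (s - l) *
        ((\<Sum>i\<le>d. real (l choose i) * 2 ^ (l - i) * x ^ i) * (\<Sum>j\<le>d. real (l choose j) * 2 ^ (l - j) * y ^ j))"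
      unfolding sum_product by (simp only: sum_distrib_left)
    then show "(\<Sum>i\<le>d. \<Sum>j\<le>d. real (s choose l) * (-2) ^ (s - l) *
        ((real (l choose i) * 2 ^ (l - i) * x ^ i) * (real (l choose j) * 2 ^ (l - j) * y ^ j)))
      = real (s choose l) * (-2) ^ (s - l) * ((x + 2) ^ l * (y + 2) ^ l)"
      by (simp only: sum_binomial_power_two[OF \<open>l \<le> d\<close>])
  qed
  also have "\<dots> = (\<Sum>l\<le>s. real (s choose l) * ((x + 2) * (y + 2)) ^ l * (-2) ^ (s - l))"
    by (intro sum.cong refl) (simp only: power_mult_distrib ac_simps)
  also have "\<dots> = ((x + 2) * (y + 2) + (-2)) ^ s"
    by (simp only: binomial_ring of_nat_id)
  also have "(x + 2) * (y + 2) + (-2) = 2 + 2 * x + 2 * y + x * y"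
    by (simp add: algebra_simps)
  finally show ?thesis .
qed

(* The dimension of the smallest cube having both cubes as faces, provided that there is one. *)
definition span_dim :: "nat \<Rightarrow> (nat \<Rightarrow> nat \<times> bool) \<Rightarrow> (nat \<Rightarrow> nat \<times> bool) \<Rightarrow> nat" where
  "span_dim d H G = card {j. j < d \<and> (H j \<noteq> G j \<or> snd (H j))}"

section \<open>Pairs of cells and of cubes whose stars meet\<close>

lemma pred_mod_eq_iff: "a < n \<Longrightarrow> b < n \<Longrightarrow> pred_mod n a = pred_mod n b \<longleftrightarrow> a = b"
  by (simp add: pred_mod_def split: if_split) arith

lemma pred_mod_eq_iff_succ_mod: "a < n \<Longrightarrow> b < n \<Longrightarrow> pred_mod n b = a \<longleftrightarrow> b = succ_mod n a"
  by (simp add: pred_mod_def succ_mod_def split: if_split) arith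

text \<open>The star of an edge is the edge alone, so it meets the stars of its faces and no
  others.\<close>

lemma star_Int_star_edge:
  assumes "c' \<in> cells n" "a < n"
  shows "star n (a, True) \<inter> star n c' \<noteq> {} \<longleftrightarrow>
    c' \<in> {(a, True), (a, False), (succ_mod n a, False)}"
proof -
  obtain b t where c': "c' = (b, t)" "b < n" using assms by (auto simp: cells_def)
  have "star n (a, True) \<inter> star n c' \<noteq> {} \<longleftrightarrow> a = b \<or> \<not> t \<and> pred_mod n b = a"
    by (cases t) (auto simp: c' star_def)
  then show ?thesis using assms c' by (cases t) (auto simp: pred_mod_eq_iff_succ_mod)
qed

text \<open>Stars meet when both cells are faces of a common cell. Around a vertex this leaves the
  vertex, its two edges and their other endpoints.\<close>

lemma star_Int_star_vertex:
  assumes "c' \<in> cells n" "a < n"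
  shows "star n (a, False) \<inter> star n c' \<noteq> {} \<longleftrightarrow>
    c' \<in> {(a, False), (a, True), (succ_mod n a, False), (pred_mod n a, False), (pred_mod n a, True)}"
proof -
  obtain b t where c': "c' = (b, t)" "b < n" using assms by (auto simp: cells_def)
  have "star n (a, False) \<inter> star n c' \<noteq> {} \<longleftrightarrow>
      a = b \<or> pred_mod n a = b \<or> \<not> t \<and> (pred_mod n b = a \<or> pred_mod n a = pred_mod n b)"
    by (cases t) (auto simp: c' star_def)
  then show ?thesis using assms c'
    by (cases t) (auto simp: pred_mod_eq_iff_succ_mod[of a n b] pred_mod_eq_iff)
qed

text \<open>Different cells with meeting stars share exactly one edge. This needs n > 2: on a circle
  of two edges both vertices bound both edges, and their stars share two cells. The condition on the
  right says that the two cells span an edge rather than a vertex.\<close>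

lemma card_star_Int_star:
  assumes "n > 2" "c \<in> cells n" "c' \<in> cells n" "star n c \<inter> star n c' \<noteq> {}"
  shows "card (star n c \<inter> star n c') = (if c \<noteq> c' \<or> snd c then 1 else 3)"
proof (cases "c = c'")
  case True
  then show ?thesis using assms card_star[of n c] by simp
next
  case False
  obtain b where b: "b \<in> star n c \<inter> star n c'" using assms by blast
  have "star n c \<inter> star n c' = {b}"
    using b False assms(1-3)
    by (cases c; cases c') (auto simp: star_def pred_mod_def cells_def split: if_splits)
  then show ?thesis using False by simp
qed

lemma cofaces_Int_cofaces:
  "cofaces d n H \<inter> cofaces d n G = PiE {..<d} (\<lambda>j. star n (H j) \<inter> star n (G j))"
  by (simp add: cofaces_def PiE_Int)

lemma card_cofaces:
  assumes "n \<ge> 2"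
  shows "card (cofaces d n H) = 3 ^ (d - cube_dim d H)"
proof -
  have "real (card (cofaces d n H)) = (\<Prod>j<d. real (card (star n (H j))))"
    by (simp add: cofaces_def card_PiE)
  also have "\<dots> = (\<Prod>j<d. if \<not> snd (H j) then 3 else 1)"
    using assms by (intro prod.cong refl) (simp add: card_star)
  also have "\<dots> = 3 ^ card {j. j < d \<and> \<not> snd (H j)}" by (rule prod_if_eq_power_card)
  also have "{j. j < d \<and> \<not> snd (H j)} = {..<d} - {j. j < d \<and> snd (H j)}" by auto
  also have "card \<dots> = d - cube_dim d H"
    unfolding cube_dim_def by (subst card_Diff_subset) auto
  finally have "real (card (cofaces d n H)) = real (3 ^ (d - cube_dim d H))" by simp
  then show ?thesis by (simp only: of_nat_eq_iff)
qed

text \<open>A factor 3 arises from each coordinate in which the two cubes have the same vertex;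
  every other coordinate leaves a single common edge.\<close>

lemma card_cofaces_Int:
  assumes n: "n > 2" and H: "H \<in> cubes d n" "G \<in> cubes d n"
    and ne: "cofaces d n H \<inter> cofaces d n G \<noteq> {}"
  shows "card (cofaces d n H \<inter> cofaces d n G) = 3 ^ (d - span_dim d H G)"
proof -
  have "real (card (cofaces d n H \<inter> cofaces d n G))
      = (\<Prod>j<d. real (card (star n (H j) \<inter> star n (G j))))"
    by (simp add: cofaces_Int_cofaces card_PiE)
  also have "\<dots> = (\<Prod>j<d. if \<not> (H j \<noteq> G j \<or> snd (H j)) then 3 else 1)"
  proof (intro prod.cong refl)
    fix j assume j: "j \<in> {..<d}"
    have "star n (H j) \<inter> star n (G j) \<noteq> {}"
      using ne j unfolding cofaces_Int_cofaces PiE_eq_empty_iff by blast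
    then show "real (card (star n (H j) \<inter> star n (G j))) = (if \<not> (H j \<noteq> G j \<or> snd (H j)) then 3 else 1)"
      using H j n by (subst card_star_Int_star) (auto simp: cubes_def)
  qed
  also have "\<dots> = 3 ^ card {j. j < d \<and> \<not> (H j \<noteq> G j \<or> snd (H j))}"
    by (rule prod_if_eq_power_card)
  also have "{j. j < d \<and> \<not> (H j \<noteq> G j \<or> snd (H j))} = {..<d} - {j. j < d \<and> (H j \<noteq> G j \<or> snd (H j))}"
    by auto
  also have "card \<dots> = d - span_dim d H G"
    unfolding span_dim_def by (subst card_Diff_subset) auto
  finally have "real (card (cofaces d n H \<inter> cofaces d n G)) = real (3 ^ (d - span_dim d H G))" by simp
  then show ?thesis by (simp only: of_nat_eq_iff)
qed

text \<open>A fixed vertex contributes 1 with itself, 2z with its neighbouring vertices and 2yz with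
  its edges; a fixed edge contributes xyz with itself and 2xz with its endpoints.\<close>

lemma sum_cell_pairs:
  fixes x y z :: real
  assumes n: "n > 2"
  shows "(\<Sum>c\<in>cells n. \<Sum>c'\<in>cells n. of_bool (star n c \<inter> star n c' \<noteq> {}) *
      (if snd c then x else 1) * (if snd c' then y else 1) * (if c \<noteq> c' \<or> snd c then z else 1))
    = real n * (1 + z * (2 + 2 * x + 2 * y + x * y))"
    (is "(\<Sum>c\<in>_. \<Sum>c'\<in>_. ?g c c') = _")
proof -
  have edge: "(\<Sum>c'\<in>cells n. ?g (a, True) c') = x * z * (y + 2)" if a: "a < n" for a
  proof -
    have "(\<Sum>c'\<in>cells n. ?g (a, True) c')
        = (\<Sum>c'\<in>{(a, True), (a, False), (succ_mod n a, False)}. x * (if snd c' then y else 1) * z)"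
    proof (rule sum.mono_neutral_cong_right)
      show "{(a, True), (a, False), (succ_mod n a, False)} \<subseteq> cells n"
        using a by (auto simp: cells_def succ_mod_def)
      show "\<forall>c'\<in>cells n - {(a, True), (a, False), (succ_mod n a, False)}. ?g (a, True) c' = 0"
        using star_Int_star_edge[OF _ a] by simp
      fix c' assume c': "c' \<in> {(a, True), (a, False), (succ_mod n a, False)}"
      then have "c' \<in> cells n" using a by (auto simp: cells_def succ_mod_def)
      from star_Int_star_edge[OF this a] c'
      have "star n (a, True) \<inter> star n c' \<noteq> {}" by blast
      then show "?g (a, True) c' = x * (if snd c' then y else 1) * z" by simp
    qed simp
    also have "\<dots> = x * z * (y + 2)"
      using n by (simp add: succ_mod_def algebra_simps)
    finally show ?thesis .
  qed
  have vertex: "(\<Sum>c'\<in>cells n. ?g (a, False) c') = 1 + 2 * z + 2 * y * z" if a: "a < n" for a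
  proof -
    let ?S = "{(a, False), (a, True), (succ_mod n a, False), (pred_mod n a, False), (pred_mod n a, True)}"
    have "(\<Sum>c'\<in>cells n. ?g (a, False) c')
        = (\<Sum>c'\<in>?S. (if snd c' then y else 1) * (if (a, False) \<noteq> c' then z else 1))"
    proof (rule sum.mono_neutral_cong_right)
      show "?S \<subseteq> cells n"
        using a by (auto simp: cells_def succ_mod_def pred_mod_def)
      show "\<forall>c'\<in>cells n - ?S. ?g (a, False) c' = 0"
        using star_Int_star_vertex[OF _ a] by simp
      fix c' assume c': "c' \<in> ?S"
      then have "c' \<in> cells n" using a by (auto simp: cells_def succ_mod_def pred_mod_def)
      from star_Int_star_vertex[OF this a] c'
      have "star n (a, False) \<inter> star n c' \<noteq> {}" by blast
      then show "?g (a, False) c' = (if snd c' then y else 1) * (if (a, False) \<noteq> c' then z else 1)"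
        by simp
    qed simp
    also have "\<dots> = 1 + 2 * z + 2 * y * z"
    proof -
      \<comment> \<open>The last inequality uses n > 2; it makes the five elements of
        \<open>?S\<close> distinct, so that none of their contributions merge.\<close>
      have "succ_mod n a \<noteq> a" "pred_mod n a \<noteq> a" "succ_mod n a \<noteq> pred_mod n a"
        using n a by (auto simp: succ_mod_def pred_mod_def)
      then show ?thesis by (simp add: algebra_simps)
    qed
    finally show ?thesis .
  qed
  have "(\<Sum>c\<in>cells n. \<Sum>c'\<in>cells n. ?g c c')
      = (\<Sum>a<n. (1 + 2 * z + 2 * y * z) + x * z * (y + 2))"
    unfolding sum_cells[of "\<lambda>c. \<Sum>c'\<in>cells n. ?g c c'"]
    by (intro sum.cong refl arg_cong2[of _ _ _ _ "(+)"] vertex edge) auto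
  then show ?thesis by (simp add: algebra_simps)
qed

text \<open>Meeting of stars and all three exponents are determined coordinatewise, so the
  generating function is the d-th power of the sum over pairs of cells. In its expansion by z,
  \<open>d choose s\<close> chooses the coordinates in which the pair spans an edge.\<close>

lemma sum_cube_pairs:
  fixes \<phi> :: "nat \<Rightarrow> nat \<Rightarrow> nat \<Rightarrow> real"
  assumes n: "n > 2"
  shows "(\<Sum>H\<in>cubes d n. \<Sum>G\<in>cubes d n. of_bool (cofaces d n H \<inter> cofaces d n G \<noteq> {}) *
       \<phi> (cube_dim d H) (cube_dim d G) (span_dim d H G))
    = real n ^ d * (\<Sum>i\<le>d. \<Sum>j\<le>d. \<Sum>s\<le>d.
        real (d choose s) * spanning_face_pairs i j s * \<phi> i j s)"
proof -
  let ?u = "\<lambda>(H, G). of_bool (cofaces d n H \<inter> cofaces d n G \<noteq> {}) :: real"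
  let ?v = "\<lambda>(i, j, s). real n ^ d * (real (d choose s) * spanning_face_pairs i j s)"
  have gen: "(\<Sum>a\<in>cubes d n \<times> cubes d n. ?u a *
         x ^ cube_dim d (fst a) * y ^ cube_dim d (snd a) * z ^ span_dim d (fst a) (snd a)) =
      (\<Sum>b\<in>{..d} \<times> {..d} \<times> {..d}. ?v b * x ^ fst b * y ^ fst (snd b) * z ^ snd (snd b))"
    for x y z :: real
  proof -
    let ?g = "\<lambda>c c'. of_bool (star n c \<inter> star n c' \<noteq> {}) *
      (if snd c then x else 1) * (if snd c' then y else 1) * (if c \<noteq> c' \<or> snd c then z else 1)"
    have "of_bool (cofaces d n H \<inter> cofaces d n G \<noteq> {}) *
         x ^ cube_dim d H * y ^ cube_dim d G * z ^ span_dim d H G = (\<Prod>j<d. ?g (H j) (G j))" for H G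
    proof -
      have "(cofaces d n H \<inter> cofaces d n G \<noteq> {}) = (\<forall>j<d. star n (H j) \<inter> star n (G j) \<noteq> {})"
        unfolding cofaces_Int_cofaces PiE_eq_empty_iff by auto
      then show ?thesis
        by (simp only: prod.distrib prod_of_bool_eq prod_if_eq_power_card cube_dim_def span_dim_def)
    qed
    then have "(\<Sum>a\<in>cubes d n \<times> cubes d n. ?u a *
         x ^ cube_dim d (fst a) * y ^ cube_dim d (snd a) * z ^ span_dim d (fst a) (snd a))
       = (\<Sum>H\<in>cubes d n. \<Sum>G\<in>cubes d n. \<Prod>j<d. ?g (H j) (G j))"
      unfolding sum.cartesian_product by (simp only: split_def)
    also have "\<dots> = (\<Sum>H\<in>cubes d n. \<Prod>j<d. \<Sum>c'\<in>cells n. ?g (H j) c')"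
      unfolding cubes_def by (subst prod_sum_PiE) auto
    also have "\<dots> = (\<Prod>j<d. \<Sum>c\<in>cells n. \<Sum>c'\<in>cells n. ?g c c')"
      unfolding cubes_def by (subst prod_sum_PiE[where f = "\<lambda>j c. \<Sum>c'\<in>cells n. ?g c c'"]) auto
    also have "\<dots> = real n ^ d * (z * (2 + 2 * x + 2 * y + x * y) + 1) ^ d"
      by (simp only: sum_cell_pairs[OF n] prod_constant card_lessThan power_mult_distrib add.commute)
    also have "(z * (2 + 2 * x + 2 * y + x * y) + 1) ^ d
        = (\<Sum>s\<le>d. real (d choose s) * z ^ s * (2 + 2 * x + 2 * y + x * y) ^ s)"
      by (simp add: binomial_ring power_mult_distrib mult.assoc)
    also have "\<dots> = (\<Sum>s\<le>d. real (d choose s) * z ^ s *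
        (\<Sum>i\<le>d. \<Sum>j\<le>d. spanning_face_pairs i j s * x ^ i * y ^ j))"
      by (intro sum.cong refl) (simp add: spanning_face_pairs_generating_function)
    also have "\<dots> = (\<Sum>i\<le>d. \<Sum>j\<le>d. \<Sum>s\<le>d. real (d choose s) * z ^ s *
        (spanning_face_pairs i j s * x ^ i * y ^ j))"
      unfolding sum_distrib_left by (subst sum.swap, subst (2) sum.swap) (rule refl)
    also have "real n ^ d * \<dots> = (\<Sum>b\<in>{..d} \<times> {..d} \<times> {..d}.
        ?v b * x ^ fst b * y ^ fst (snd b) * z ^ snd (snd b))"
      unfolding sum_distrib_left sum.cartesian_product split_def
      by (intro sum.cong refl) (simp only: fst_conv snd_conv ac_simps)
    finally show ?thesis .
  qed
  have "(\<Sum>a\<in>cubes d n \<times> cubes d n. ?u a *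
         \<phi> (cube_dim d (fst a)) (cube_dim d (snd a)) (span_dim d (fst a) (snd a))) =
      (\<Sum>b\<in>{..d} \<times> {..d} \<times> {..d}. ?v b * \<phi> (fst b) (fst (snd b)) (snd (snd b)))"
    by (rule sum_power3_eq[OF _ _ gen]) auto
  then show ?thesis
    unfolding sum.cartesian_product split_def by (simp add: sum_distrib_left mult.assoc)
qed

section \<open>Moments of the intrinsic volumes\<close>

definition cube_weight :: "nat \<Rightarrow> nat \<Rightarrow> real" where
  "cube_weight k i = (-1) ^ (i - k) * real (i choose k)"

definition selection :: "nat \<Rightarrow> nat \<Rightarrow> real \<Rightarrow> ((nat \<Rightarrow> real) set \<Rightarrow> bool) pmf" where
  "selection d n p = Pi_pmf (cube d ` cubes d n) False (\<lambda>_. bernoulli_pmf p)"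

definition uncovered :: "nat \<Rightarrow> nat \<Rightarrow> (nat \<Rightarrow> nat \<times> bool) \<Rightarrow> ((nat \<Rightarrow> real) set \<Rightarrow> bool) \<Rightarrow> real" where
  "uncovered d n H sel = of_bool (\<forall>G\<in>cofaces d n H. \<not> sel (cube d G))"

lemma integrable_selection [simp]: "integrable (measure_pmf (selection d n p)) (f :: _ \<Rightarrow> real)"
proof (rule integrable_measure_pmf_finite)
  show "finite (set_pmf (selection d n p))"
    unfolding selection_def by (subst set_Pi_pmf) (auto intro!: finite_PiE_dflt)
qed

text \<open>A product event: the bit is False on the cubes of \<open>S\<close> and unrestricted
  elsewhere, so independence gives one factor 1 - p for each of the \<open>card S\<close> distinct
  cubes.\<close>

lemma expectation_none_selected:
  assumes p: "0 \<le> p" "p \<le> 1" and S: "S \<subseteq> cubes d n"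
  shows "measure_pmf.expectation (selection d n p) (\<lambda>sel. of_bool (\<forall>G\<in>S. \<not> sel (cube d G)))
    = (1 - p) ^ card S"
proof -
  let ?A = "cube d ` cubes d n"
  let ?B = "\<lambda>Q. if Q \<in> cube d ` S then {False} else UNIV"
  have inj: "inj_on (cube d) S" using inj_on_cube S by (rule inj_on_subset)
  have "(\<lambda>sel. of_bool (\<forall>G\<in>S. \<not> sel (cube d G))) = (indicator (Pi ?A ?B) :: _ \<Rightarrow> real)"
    using S by (intro ext) (auto simp: indicator_def Pi_def of_bool_def)
  then have "measure_pmf.expectation (selection d n p) (\<lambda>sel. of_bool (\<forall>G\<in>S. \<not> sel (cube d G)))
      = measure_pmf.prob (selection d n p) (Pi ?A ?B)" by simp
  also have "\<dots> = (\<Prod>Q\<in>?A. measure_pmf.prob (bernoulli_pmf p) (?B Q))"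
    unfolding selection_def by (rule measure_Pi_pmf_Pi) simp
  also have "\<dots> = (\<Prod>Q\<in>?A. if Q \<in> cube d ` S then 1 - p else 1)"
    using p by (intro prod.cong refl) (simp add: measure_pmf_single)
  also have "\<dots> = (\<Prod>Q\<in>cube d ` S. 1 - p)"
    using S by (intro prod.mono_neutral_cong_right) auto
  also have "\<dots> = (1 - p) ^ card S" by (simp add: card_image[OF inj])
  finally show ?thesis .
qed

lemma expectation_uncovered:
  assumes "0 \<le> p" "p \<le> 1" "n \<ge> 2" "H \<in> cubes d n"
  shows "measure_pmf.expectation (selection d n p) (uncovered d n H)
    = 1 - face_prob d (1 - p) (cube_dim d H)"
  using expectation_none_selected[OF assms(1,2) cofaces_subset[OF assms(4)]] assms
  by (simp add: uncovered_def[abs_def] card_cofaces face_prob_def)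

text \<open>The product of the two indicators is the indicator that nothing in the union of the two
  stars is selected.\<close>

lemma expectation_uncovered_mult:
  assumes "0 \<le> p" "p \<le> 1" "H \<in> cubes d n" "G \<in> cubes d n"
  shows "measure_pmf.expectation (selection d n p) (\<lambda>sel. uncovered d n H sel * uncovered d n G sel)
    = (1 - p) ^ card (cofaces d n H \<union> cofaces d n G)"
proof -
  have "(\<lambda>sel. uncovered d n H sel * uncovered d n G sel)
      = (\<lambda>sel. of_bool (\<forall>F\<in>cofaces d n H \<union> cofaces d n G. \<not> sel (cube d F)))"
    by (auto simp: uncovered_def ball_Un simp flip: of_bool_conj)
  then show ?thesis
    using expectation_none_selected[OF assms(1,2), of "cofaces d n H \<union> cofaces d n G"]
      cofaces_subset assms(3,4) by simp
qed

text \<open>Stars of sizes a = \<open>3 ^ (d - i)\<close> and b = \<open>3 ^ (d - j)\<close> that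
  share c = \<open>3 ^ (d - s)\<close> cubes have a union of size a + b - c; the right side is the
  covariance of the two absence events. The hypotheses give c \<le> a and c \<le> b, so no
  subtraction truncates.\<close>

lemma joint_face_prob_eq:
  assumes "i \<le> s" "j \<le> s"
  shows "joint_face_prob d q i j s - face_prob d q i * face_prob d q j
    = q ^ (3 ^ (d - i) + 3 ^ (d - j) - 3 ^ (d - s)) - q ^ (3 ^ (d - i) + 3 ^ (d - j))"
proof -
  let ?a = "3 ^ (d - i) :: nat" and ?b = "3 ^ (d - j) :: nat" and ?c = "3 ^ (d - s) :: nat"
  have "?c \<le> ?a" "?c \<le> ?b" using assms by (auto intro!: power_increasing)
  then obtain a b where a: "?a = ?c + a" and b: "?b = ?c + b" by (metis le_iff_add)
  show ?thesis
    unfolding joint_face_prob_def face_prob_def a b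
    by (simp add: power_add algebra_simps)
qed

lemma cube_dim_le_span_dim:
  "cube_dim d H \<le> span_dim d H G" "cube_dim d G \<le> span_dim d H G"
  unfolding cube_dim_def span_dim_def by (auto intro!: card_mono)

text \<open>If the stars are disjoint, the size of their union is additive in the exponent of q and
  the covariance vanishes; otherwise inclusion-exclusion for the union leads to
  \<open>joint_face_prob_eq\<close>.\<close>

lemma covariance_uncovered:
  assumes p: "0 \<le> p" "p \<le> 1" and n: "n > 2" and H: "H \<in> cubes d n" "G \<in> cubes d n"
  defines "q \<equiv> 1 - p" and "i \<equiv> cube_dim d H" and "j \<equiv> cube_dim d G"
  shows "measure_pmf.expectation (selection d n p) (\<lambda>sel. uncovered d n H sel * uncovered d n G sel)
      - (1 - face_prob d q i) * (1 - face_prob d q j)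
    = of_bool (cofaces d n H \<inter> cofaces d n G \<noteq> {}) *
      (joint_face_prob d q i j (span_dim d H G) - face_prob d q i * face_prob d q j)"
proof -
  have cards: "card (cofaces d n H) = 3 ^ (d - i)" "card (cofaces d n G) = 3 ^ (d - j)"
    using n by (simp_all add: card_cofaces i_def j_def)
  have indep: "(1 - face_prob d q i) * (1 - face_prob d q j) = q ^ (3 ^ (d - i) + 3 ^ (d - j))"
    by (simp add: face_prob_def power_add)
  have E: "measure_pmf.expectation (selection d n p) (\<lambda>sel. uncovered d n H sel * uncovered d n G sel)
      = q ^ card (cofaces d n H \<union> cofaces d n G)"
    unfolding q_def by (rule expectation_uncovered_mult[OF p H])
  show ?thesis
  proof (cases "cofaces d n H \<inter> cofaces d n G = {}")
    case True
    then have "card (cofaces d n H \<union> cofaces d n G) = 3 ^ (d - i) + 3 ^ (d - j)"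
      by (simp add: card_Un_disjoint cards)
    then show ?thesis using True E indep by simp
  next
    case False
    have "card (cofaces d n H \<union> cofaces d n G)
        = 3 ^ (d - i) + 3 ^ (d - j) - 3 ^ (d - span_dim d H G)"
      using card_Un_Int[of "cofaces d n H" "cofaces d n G"] card_cofaces_Int[OF n H False]
      by (simp add: cards)
    moreover have "i \<le> span_dim d H G" "j \<le> span_dim d H G"
      unfolding i_def j_def by (rule cube_dim_le_span_dim)+
    ultimately show ?thesis using False E indep by (simp add: joint_face_prob_eq)
  qed
qed

text \<open>Pulls the model back to the independent selection bits. From here on the topology enters
  only through the indicators \<open>uncovered\<close>.\<close>

lemma closed_faces_model_eq:
  assumes "n \<ge> 2"
  obtains C where "closed_faces_model d n p = map_pmf C (selection d n p)"
    and "\<And>sel. intrinsic_volume d n k (C sel)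
      = (\<Sum>H\<in>cubes d n. cube_weight k (cube_dim d H) * (1 - uncovered d n H sel))"
proof
  let ?C = "\<lambda>sel. torus d n closure_of \<Union>{Q. \<exists>i\<le>d. Q \<in> open_cubes d n i \<and> sel Q}"
  show "closed_faces_model d n p = map_pmf ?C (selection d n p)"
    by (simp only: closed_faces_model_def selection_def UN_open_cubes)
  fix sel
  have "of_bool (cube d H \<subseteq> ?C sel) = 1 - uncovered d n H sel" if "H \<in> cubes d n" for H
    by (simp add: cube_subset_closure_iff[OF assms that] uncovered_def of_bool_def)
  then show "intrinsic_volume d n k (?C sel)
      = (\<Sum>H\<in>cubes d n. cube_weight k (cube_dim d H) * (1 - uncovered d n H sel))"
    unfolding intrinsic_volume_eq cube_weight_def by (intro sum.cong refl) simp
qed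

lemma expectation_intrinsic_volume:
  assumes p: "0 \<le> p" "p \<le> 1" and n: "n \<ge> 2"
  shows "measure_pmf.expectation (closed_faces_model d n p) (intrinsic_volume d n k)
    = (\<Sum>H\<in>cubes d n. cube_weight k (cube_dim d H) * face_prob d (1 - p) (cube_dim d H))"
proof -
  obtain C where C: "closed_faces_model d n p = map_pmf C (selection d n p)"
    "\<And>sel. intrinsic_volume d n k (C sel)
      = (\<Sum>H\<in>cubes d n. cube_weight k (cube_dim d H) * (1 - uncovered d n H sel))"
    using closed_faces_model_eq[OF n] by blast
  show ?thesis
    using n by (simp add: C expectation_uncovered[OF p])
qed

text \<open>The centred variable is a weighted sum of \<open>?m H - ?Z H sel\<close>, so its square
  is a double sum and the variance is the sum of all weighted covariances.\<close>

lemma variance_intrinsic_volume: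
  assumes p: "0 \<le> p" "p \<le> 1" and n: "n > 2"
  defines "q \<equiv> 1 - p"
  shows "measure_pmf.variance (closed_faces_model d n p) (intrinsic_volume d n k)
    = (\<Sum>H\<in>cubes d n. \<Sum>G\<in>cubes d n. of_bool (cofaces d n H \<inter> cofaces d n G \<noteq> {}) *
        (cube_weight k (cube_dim d H) * cube_weight k (cube_dim d G) *
         (joint_face_prob d q (cube_dim d H) (cube_dim d G) (span_dim d H G)
          - face_prob d q (cube_dim d H) * face_prob d q (cube_dim d G))))"
proof -
  let ?w = "\<lambda>H. cube_weight k (cube_dim d H)" and ?m = "\<lambda>H. 1 - face_prob d q (cube_dim d H)"
  let ?Z = "uncovered d n" and ?M = "measure_pmf (selection d n p)"
  obtain C where C: "closed_faces_model d n p = map_pmf C (selection d n p)"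
    "\<And>sel. intrinsic_volume d n k (C sel) = (\<Sum>H\<in>cubes d n. ?w H * (1 - ?Z H sel))"
    using closed_faces_model_eq[of n] n by (metis less_imp_le_nat)
  have E: "measure_pmf.expectation (closed_faces_model d n p) (intrinsic_volume d n k)
      = (\<Sum>H\<in>cubes d n. ?w H * (1 - ?m H))"
    using n p by (simp add: expectation_intrinsic_volume q_def)
  have Z: "integral\<^sup>L ?M (?Z H) = ?m H" if "H \<in> cubes d n" for H
    using expectation_uncovered[OF p _ that] n by (simp add: q_def)
  have "(intrinsic_volume d n k (C sel) - (\<Sum>H\<in>cubes d n. ?w H * (1 - ?m H)))\<^sup>2
      = (\<Sum>H\<in>cubes d n. \<Sum>G\<in>cubes d n. ?w H * ?w G *
          (?m H * ?m G - ?m H * ?Z G sel - ?m G * ?Z H sel + ?Z H sel * ?Z G sel))" for sel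
  proof -
    have "intrinsic_volume d n k (C sel) - (\<Sum>H\<in>cubes d n. ?w H * (1 - ?m H))
        = (\<Sum>H\<in>cubes d n. ?w H * (?m H - ?Z H sel))"
      unfolding C(2) sum_subtractf[symmetric] by (intro sum.cong refl) (simp add: algebra_simps)
    then show ?thesis
      unfolding power2_eq_square sum_product
      by (simp only: sum_product) (intro sum.cong refl; simp add: algebra_simps)
  qed
  then have "measure_pmf.variance (closed_faces_model d n p) (intrinsic_volume d n k)
      = (\<integral>sel. (\<Sum>H\<in>cubes d n. \<Sum>G\<in>cubes d n. ?w H * ?w G *
          (?m H * ?m G - ?m H * ?Z G sel - ?m G * ?Z H sel + ?Z H sel * ?Z G sel)) \<partial>?M)"
    unfolding E by (simp add: C(1))
  also have "\<dots> = (\<Sum>H\<in>cubes d n. \<Sum>G\<in>cubes d n. ?w H * ?w G *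
      (integral\<^sup>L ?M (\<lambda>sel. ?Z H sel * ?Z G sel) - ?m H * ?m G))"
    by (simp add: Z algebra_simps)
  also have "\<dots> = (\<Sum>H\<in>cubes d n. \<Sum>G\<in>cubes d n. of_bool (cofaces d n H \<inter> cofaces d n G \<noteq> {}) *
        (?w H * ?w G *
         (joint_face_prob d q (cube_dim d H) (cube_dim d G) (span_dim d H G)
          - face_prob d q (cube_dim d H) * face_prob d q (cube_dim d G))))"
    unfolding q_def
    by (intro sum.cong refl) (simp only: covariance_uncovered[OF p n] ac_simps)
  finally show ?thesis .
qed

section \<open>Binomial identities and the final summation\<close>

text \<open>After \<open>choose_mult\<close> only an alternating sum over the row d - k of Pascal's
  triangle is left. The value is the normalized k-th intrinsic volume of the whole torus, and it is
  the source of the case distinction between k < d and k = d.\<close>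

lemma sum_binomial_cube_weight:
  assumes "k \<le> d"
  shows "(\<Sum>i=k..d. real (d choose i) * cube_weight k i) = of_bool (k = d)"
proof -
  have "real (d choose i) * cube_weight k i
      = real (d choose k) * ((-1) ^ (i - k) * real ((d - k) choose (i - k)))"
    if "i \<in> {k..d}" for i
  proof -
    have "(d choose i) * (i choose k) = (d choose k) * ((d - k) choose (i - k))"
      using that by (intro choose_mult) auto
    then have "real (d choose i) * real (i choose k) = real (d choose k) * real ((d - k) choose (i - k))"
      by (simp flip: of_nat_mult)
    then show ?thesis by (simp add: cube_weight_def)
  qed
  then have "(\<Sum>i=k..d. real (d choose i) * cube_weight k i)
      = real (d choose k) * (\<Sum>i=k..d. (-1) ^ (i - k) * real ((d - k) choose (i - k)))"
    by (simp add: sum_distrib_left)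
  also have "(\<Sum>i=k..d. (-1) ^ (i - k) * real ((d - k) choose (i - k)))
      = (\<Sum>i\<le>d - k. (-1) ^ i * real ((d - k) choose i))"
    using assms by (intro sum.reindex_bij_witness[of _ "\<lambda>i. i + k" "\<lambda>i. i - k"]) auto
  also have "\<dots> = of_bool (k = d)"
    using choose_alternating_sum[of "d - k", where ?'a = real] assms by (cases "k = d") auto
  finally show ?thesis by auto
qed

text \<open>The exponents i - k and j - k add up to i + j minus the even number 2k; if k exceeds i
  or j, both sides are 0.\<close>

lemma cube_weight_mult:
  "cube_weight k i * cube_weight k j = (-1) ^ (i + j) * real (i choose k) * real (j choose k)"
proof (cases "k \<le> i \<and> k \<le> j")
  case True
  then have "i + j = (i - k) + (j - k) + 2 * k" by linarith
  then have "(-1 :: real) ^ (i + j) = (-1) ^ (i - k) * (-1) ^ (j - k)"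
    by (simp only: power_add power_mult) simp
  then show ?thesis by (simp add: cube_weight_def)
next
  case False
  then show ?thesis by (auto simp: cube_weight_def not_le)
qed

theorem proposition11:
  fixes d n k :: nat and p q :: real
  assumes "n \<ge> 2" and "k \<le> d" and "0 \<le> p" and "p \<le> 1" and "q = 1 - p"
  shows "measure_pmf.expectation (closed_faces_model d n p) (intrinsic_volume d n k) / real n ^ d =
      (if k < d
       then \<Sum>i=k..d. (-1) ^ (i - k + 1) * real (d choose i) * real (i choose k) * q ^ 3 ^ (d - i)
       else 1 - q)
    \<and> (n > 2 \<longrightarrow>
        measure_pmf.variance (closed_faces_model d n p) (intrinsic_volume d n k) / real n ^ d =
        (\<Sum>i\<le>d. \<Sum>j\<le>d. \<Sum>s\<le>d. (-1) ^ (i + j) * real (i choose k) * real (j choose k) *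
           real (d choose s) * spanning_face_pairs i j s *
           (joint_face_prob d q i j s - face_prob d q i * face_prob d q j)))"
proof (intro conjI impI)
  have "measure_pmf.expectation (closed_faces_model d n p) (intrinsic_volume d n k) / real n ^ d
      = (\<Sum>i\<le>d. real (d choose i) * (cube_weight k i * face_prob d q i))"
    using assms(1) sum_cubes_by_dim[of "\<lambda>i. cube_weight k i * face_prob d q i" d n]
    by (simp add: expectation_intrinsic_volume[OF assms(3,4,1)] assms(5))
  also have "\<dots> = (\<Sum>i=k..d. real (d choose i) * (cube_weight k i * face_prob d q i))"
    by (rule sum.mono_neutral_right) (auto simp: cube_weight_def)
  \<comment> \<open>The two parts of P_i = 1 - \<open>q ^ 3 ^ (d - i)\<close> are summed separately;
    the minus sign is absorbed into the exponent i - k + 1.\<close>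
  also have "\<dots> = (\<Sum>i=k..d. real (d choose i) * cube_weight k i)
      + (\<Sum>i=k..d. (-1) ^ (i - k + 1) * real (d choose i) * real (i choose k) * q ^ 3 ^ (d - i))"
    unfolding sum.distrib[symmetric]
    by (intro sum.cong refl) (simp add: face_prob_def cube_weight_def algebra_simps)
  also have "\<dots> = (if k < d
       then \<Sum>i=k..d. (-1) ^ (i - k + 1) * real (d choose i) * real (i choose k) * q ^ 3 ^ (d - i)
       else 1 - q)"
    \<comment> \<open>For k = d the second sum consists of the term i = d alone, which is -q because
      \<open>3 ^ 0 = 1\<close>.\<close>
    using assms(2) by (auto simp: sum_binomial_cube_weight)
  finally show "measure_pmf.expectation (closed_faces_model d n p) (intrinsic_volume d n k) / real n ^ d =
      (if k < d
       then \<Sum>i=k..d. (-1) ^ (i - k + 1) * real (d choose i) * real (i choose k) * q ^ 3 ^ (d - i)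
       else 1 - q)" .
next
  assume n: "n > 2"
  have "measure_pmf.variance (closed_faces_model d n p) (intrinsic_volume d n k) / real n ^ d
      = (\<Sum>i\<le>d. \<Sum>j\<le>d. \<Sum>s\<le>d. real (d choose s) * spanning_face_pairs i j s *
          (cube_weight k i * cube_weight k j *
           (joint_face_prob d q i j s - face_prob d q i * face_prob d q j)))"
    unfolding variance_intrinsic_volume[OF assms(3,4) n] assms(5)
    using n by (subst sum_cube_pairs[OF n]) simp
  also have "\<dots> = (\<Sum>i\<le>d. \<Sum>j\<le>d. \<Sum>s\<le>d. (-1) ^ (i + j) * real (i choose k) * real (j choose k) *
           real (d choose s) * spanning_face_pairs i j s *
           (joint_face_prob d q i j s - face_prob d q i * face_prob d q j))"
    by (intro sum.cong refl) (simp only: cube_weight_mult ac_simps)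
  finally show "measure_pmf.variance (closed_faces_model d n p) (intrinsic_volume d n k) / real n ^ d =
      (\<Sum>i\<le>d. \<Sum>j\<le>d. \<Sum>s\<le>d. (-1) ^ (i + j) * real (i choose k) * real (j choose k) *
           real (d choose s) * spanning_face_pairs i j s *
           (joint_face_prob d q i j s - face_prob d q i * face_prob d q j))" .
qed

end
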